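(* For each $N\ge 1$ consider the leader-follower system on the $N\times N\times N$ 3D directed lattice, $\dot{\mathbf{x}} = -L_3\mathbf{x} + d$, where $L_3 \in \mathbb{R}^{N^3\times N^3}$ is the lower triangular block Toeplitz matrix, with $N^2\times N^2$ blocks, having $K$ on the main block diagonal, $-I$ on the first block subdiagonal and $0$ in every other block; $K\in\mathbb{R}^{N^2\times N^2}$ is the lower triangular block Toeplitz matrix, with $N\times N$ blocks, having $K_3$ on the main block diagonal, $-I$ on the first block subdiagonal and $0$ in every other block; and $K_3\in\mathbb{R}^{N\times N}$ is the lower triangular Toeplitz matrix with $3$ on the main diagonal, $-1$ on the first subdiagonal, and $0$ everywhere else. For $n=1,\ldots,N$ let $V_n$ be the steady-state variance of the follower at coordinates $(n,n,n)$ of the lattice, i.e. the corresponding diagonal entry of $P=\int_0^\infty e^{-L_3 t}e^{-L_3^T t}\,dt$ (the $n$th diagonal element of the $n$th $N\times N$ diagonal block of the $n$th $N^2\times N^2$ diagonal block of $P$). Then $V_n$ is bounded above by a constant independent of the network size: there exists a constant $C$ such that $V_n\le C$ for all $N\ge 1$ and all $1\le n\le N$.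
   Context: The 3D leader-follower system has followers indexed by $(n,m,l)$, $1\le n,m,l\le N$, with scalar states obeying $\dot{x}_{n,m,l} = -(x_{n,m,l}-x_{n-1,m,l}) - (x_{n,m,l}-x_{n,m-1,l}) - (x_{n,m,l}-x_{n,m,l-1}) + d_{n,m,l}$, with boundary values $x_{0,m,l}=x_{n,0,l}=x_{n,m,0}=x_0\equiv 0$ (the leader's state). Stacking the states gives $\dot{\mathbf{x}}=-L_3\mathbf{x}+d$ with $L_3$ as in the claim. The disturbance $d$ is zero-mean, unit-variance white noise, uncorrelated across followers (identity intensity matrix), so the steady-state covariance $\lim_{t\to\infty}E\{\mathbf{x}(t)\mathbf{x}^T(t)\}$ equals $P=\int_0^\infty e^{-L_3 t}e^{-L_3^T t}\,dt$. The steady-state variance of a follower is the corresponding diagonal entry of $P$. *)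

theory Defs
  imports "HOL-Analysis.Henstock_Kurzweil_Integration" "Jordan_Normal_Form.Matrix"
begin

definition K3_mat :: "nat \<Rightarrow> real mat" where
  "K3_mat N = Matrix.mat N N (\<lambda>(i, j). if i = j then 3 else if i = Suc j then - 1 else 0)"

text \<open>\<open>N \<times> N\<close> blocks of size \<open>b \<times> b\<close>: entry \<open>(i, j)\<close> lies in block \<open>(i div b, j div b)\<close> at
  position \<open>(i mod b, j mod b)\<close>.\<close>

definition block_toeplitz :: "nat \<Rightarrow> nat \<Rightarrow> real mat \<Rightarrow> real mat" where
  "block_toeplitz N b D = Matrix.mat (N * b) (N * b) (\<lambda>(i, j).
     (if i div b = j div b then D
      else if i div b = Suc (j div b) then - 1\<^sub>m b
      else 0\<^sub>m b b) $$ (i mod b, j mod b))"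

definition K_mat :: "nat \<Rightarrow> real mat" where
  "K_mat N = block_toeplitz N N (K3_mat N)"

definition L3_mat :: "nat \<Rightarrow> real mat" where
  "L3_mat N = block_toeplitz N (N^2) (K_mat N)"

text \<open>The exponential series converges absolutely in each entry for every square matrix, so
  the infinite sums below are genuine limits.\<close>

definition mat_exp :: "real mat \<Rightarrow> real mat" where
  "mat_exp A = Matrix.mat (dim_row A) (dim_row A) (\<lambda>(i, j). \<Sum>k. (A ^\<^sub>m k) $$ (i, j) / fact k)"

definition cov_integrand :: "nat \<Rightarrow> real \<Rightarrow> real mat" where
  "cov_integrand N t =
     mat_exp ((- t) \<cdot>\<^sub>m L3_mat N) * mat_exp ((- t) \<cdot>\<^sub>m transpose_mat (L3_mat N))"

definition steady_state_cov :: "nat \<Rightarrow> real mat" where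
  "steady_state_cov N =
     Matrix.mat (N^3) (N^3) (\<lambda>(i, j). integral {0..} (\<lambda>t. cov_integrand N t $$ (i, j)))"

text \<open>Lattice coordinates run from \<open>1\<close> to \<open>N\<close>, matrix indices from \<open>0\<close>.\<close>

definition lattice_index :: "nat \<Rightarrow> nat \<Rightarrow> nat \<Rightarrow> nat \<Rightarrow> nat" where
  "lattice_index N n m l = (n - 1) * N^2 + (m - 1) * N + (l - 1)"

definition follower_variance :: "nat \<Rightarrow> nat \<Rightarrow> nat \<Rightarrow> nat \<Rightarrow> real" where
  "follower_variance N n m l =
     steady_state_cov N $$ (lattice_index N n m l, lattice_index N n m l)"

end

theory Submission
  imports Defs "HOL-Analysis.Equivalence_Lebesgue_Henstock_Integration"
begin

text \<open>
  Write \<open>L\<^sub>3 = 3 I - S\<close>, where \<open>S\<close> is the sum of the three commuting unit shifts of the lattice. The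
  entries of \<open>S^p\<close> count lattice paths and are multinomial coefficients, so, in coordinates counted
  from \<open>0\<close>, the entry of \<open>exp (- L\<^sub>3 t)\<close> from \<open>(a, b, c)\<close> to \<open>(n, m, l)\<close> is a product of three Poisson
  weights
  \<open>exp (- 3 t) t^((n - a) + (m - b) + (l - c)) / ((n - a)! (m - b)! (l - c)!)\<close>
  when \<open>a \<le> n\<close>, \<open>b \<le> m\<close>, \<open>c \<le> l\<close>, and \<open>0\<close> otherwise (lemma \<open>mat_exp_L3_entry\<close>). Each entry of the
  integrand \<open>exp (- L\<^sub>3 t) exp (- L\<^sub>3\<^sup>T t)\<close> is therefore a finite combination of functions
  \<open>exp (- 6 t) t^k\<close>, hence integrable.

  At the diagonal site \<open>(n, n, n)\<close> the sum over the lattice factorises, and the integrand is \<open>f^3\<close> with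
  \<open>f t = exp (- 2 t) (\<Sum>k\<le>n. (t^k / k!)^2)\<close> (lemma \<open>cov_integrand_diagonal\<close>). This \<open>f\<close> is a partial sum
  of \<open>exp (- 2 t) I\<^sub>0 (2 t)\<close>, where \<open>I\<^sub>0\<close> is the modified Bessel function, so it decays like \<open>t^(-1/2)\<close>
  uniformly in \<open>n\<close>, and in dimension three \<open>f^3\<close> is bounded by a multiple of \<open>t^(-3/2)\<close>, which is
  integrable at infinity.

  The decay is obtained without Bessel asymptotics (lemma \<open>chain_energy_bounds\<close>). With \<open>s = 2 t\<close> and
  \<open>c\<^sub>k = (2 k choose k) / 4^k\<close> one has \<open>(t^k / k!)^2 = c\<^sub>k s^(2 k) / (2 k)!\<close>, and \<open>(2 k + 1) c\<^sub>k\<^sup>2 \<le> 1\<close>. The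
  Cauchy-Schwarz inequality with weights \<open>s^(2 k) / (2 k)!\<close> bounds the square of the sum by
  \<open>exp s (\<Sum>k. s^(2 k) / (2 k + 1)!) \<le> exp s \<cdot> exp s / s\<close>, that is, \<open>2 t (f t)^2 \<le> 1\<close>. Together with \<open>f \<le> 1\<close>
  on \<open>[0, 1]\<close> this gives the variance bound \<open>1 + 2 = 3\<close>.
\<close>

section \<open>Lattice coordinates\<close>

lemma sum_lessThan_times:
  fixes f :: "nat \<Rightarrow> 'a::comm_monoid_add"
  shows "(\<Sum>i<N * b. f i) = (\<Sum>q<N. \<Sum>r<b. f (q * b + r))"
proof -
  have "(\<Sum>i<N * b. f i) = (\<Sum>q<N. sum f {q * b..<q * b + b})"
    by (rule sum.nat_group[symmetric])
  also have "\<dots> = (\<Sum>q<N. \<Sum>r<b. f (q * b + r))"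
  proof (rule sum.cong[OF refl])
    fix q
    show "sum f {q * b..<q * b + b} = (\<Sum>r<b. f (q * b + r))"
      using sum.shift_bounds_nat_ivl[of f 0 "q * b" b]
      by (simp add: add.commute atLeast0LessThan)
  qed
  finally show ?thesis .
qed

text \<open>The position of the lattice point \<open>(a, b, c)\<close>, coordinates counted from \<open>0\<close>, in the stacked
  state vector.\<close>

definition site :: "nat \<Rightarrow> nat \<Rightarrow> nat \<Rightarrow> nat \<Rightarrow> nat" where
  "site N a b c = a * N^2 + (b * N + c)"

lemma block_index_less:
  fixes q :: nat
  assumes "q < N" "r < b"
  shows "q * b + r < N * b"
proof -
  have "q * b + r < Suc q * b" using assms by simp
  also have "\<dots> \<le> N * b" using assms by (intro mult_le_mono1) simp
  finally show ?thesis .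
qed

lemma site_less:
  assumes "a < N" "b < N" "c < N"
  shows "site N a b c < N^3"
  using block_index_less[OF assms(1) block_index_less[OF assms(2,3)]]
  by (simp add: site_def power2_eq_square power3_eq_cube)

lemma sum_lattice:
  fixes f :: "nat \<Rightarrow> 'a::comm_monoid_add"
  shows "(\<Sum>i<N^3. f i) = (\<Sum>a<N. \<Sum>b<N. \<Sum>c<N. f (site N a b c))"
proof -
  have "N^3 = N * (N * N)" by (simp add: power3_eq_cube)
  then show ?thesis
    by (simp only: sum_lessThan_times site_def power2_eq_square)
qed

lemma site_cases:
  assumes "i < N^3"
  obtains a b c where "a < N" "b < N" "c < N" "i = site N a b c"
proof -
  have N: "N > 0" using assms by (cases N) auto
  have "i div N^2 < N" "i mod N^2 div N < N"
    using assms N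
    by (simp_all add: less_mult_imp_div_less power2_eq_square power3_eq_cube mult.assoc)
  moreover have "i = site N (i div N^2) (i mod N^2 div N) (i mod N^2 mod N)"
    by (simp only: site_def div_mult_mod_eq)
  moreover have "i mod N^2 mod N < N" using N by simp
  ultimately show thesis by (metis that)
qed

section \<open>The exponential of the lattice Laplacian\<close>

lemma block_toeplitz_dim [simp]:
  "dim_row (block_toeplitz N b D) = N * b" "dim_col (block_toeplitz N b D) = N * b"
  by (simp_all add: block_toeplitz_def)

lemma block_toeplitz_entry:
  assumes "q < N" "q' < N" "r < b" "r' < b"
  shows "block_toeplitz N b D $$ (q * b + r, q' * b + r') =
    (if q = q' then D $$ (r, r') else if q = Suc q' then (if r = r' then -1 else 0) else 0)"
  using assms block_index_less[of q N r b] block_index_less[of q' N r' b]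
  by (simp add: block_toeplitz_def)

lemma L3_mat_carrier: "L3_mat N \<in> carrier_mat (N^3) (N^3)"
  by (auto simp: L3_mat_def power2_eq_square power3_eq_cube)

lemma L3_mat_entry:
  assumes "n < N" "m < N" "l < N" "a < N" "b < N" "c < N"
  shows "L3_mat N $$ (site N n m l, site N a b c) =
    (if n = a \<and> m = b \<and> l = c then 3
     else if n = Suc a \<and> m = b \<and> l = c \<or> n = a \<and> m = Suc b \<and> l = c \<or> n = a \<and> m = b \<and> l = Suc c
       then -1 else 0)"
proof -
  have in_block: "m * N + l < N^2" "b * N + c < N^2"
    using assms block_index_less[of _ N _ N] by (auto simp: power2_eq_square)
  have eq: "m * N + l = b * N + c \<longleftrightarrow> m = b \<and> l = c"
  proof
    assume *: "m * N + l = b * N + c"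
    have "m = (m * N + l) div N" "l = (m * N + l) mod N" using assms by auto
    moreover have "b = (b * N + c) div N" "c = (b * N + c) mod N" using assms by auto
    ultimately show "m = b \<and> l = c" using * by metis
  qed simp
  show ?thesis
    unfolding L3_mat_def site_def block_toeplitz_entry[OF assms(1,4) in_block]
      K_mat_def block_toeplitz_entry[OF assms(2,5,3,6)] eq
    using assms by (auto simp: K3_mat_def)
qed

text \<open>The coefficient \<open>1 / (n - a)!\<close> with which the position \<open>a\<close> of a chain acts on the position \<open>n\<close>; it
  vanishes for \<open>n < a\<close>, as disturbances only travel downstream.\<close>

definition inv_fact :: "nat \<Rightarrow> nat \<Rightarrow> real" where
  "inv_fact n a = (if a \<le> n then 1 / fact (n - a) else 0)"

text \<open>The recurrence holds for all \<open>n\<close> and \<open>a\<close>: for \<open>n \<le> a\<close> both sides vanish, as \<open>n - a\<close> is then \<open>0\<close>.\<close>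

lemma inv_fact_Suc: "inv_fact n (Suc a) = real (n - a) * inv_fact n a"
proof (cases "a < n")
  case True
  then have "n - a = Suc (n - Suc a)" by simp
  then have "(fact (n - a)::real) = real (n - a) * fact (n - Suc a)" by (metis fact_Suc)
  then show ?thesis using True by (simp add: inv_fact_def)
qed (auto simp: inv_fact_def)

text \<open>The number of lattice steps from \<open>(a, b, c)\<close> to \<open>(n, m, l)\<close>; meaningful only when
  \<open>a \<le> n\<close>, \<open>b \<le> m\<close>, \<open>c \<le> l\<close>, since subtraction is truncated.\<close>

definition lat_dist :: "nat \<Rightarrow> nat \<Rightarrow> nat \<Rightarrow> nat \<Rightarrow> nat \<Rightarrow> nat \<Rightarrow> nat" where
  "lat_dist n m l a b c = (n - a) + (m - b) + (l - c)"

text \<open>The number of lattice paths from \<open>(a, b, c)\<close> to \<open>(n, m, l)\<close>, divided by the factorial of their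
  length; \<open>0\<close> if there is no path, which makes the truncation in the distance harmless.\<close>

definition path_weight :: "nat \<Rightarrow> nat \<Rightarrow> nat \<Rightarrow> nat \<Rightarrow> nat \<Rightarrow> nat \<Rightarrow> real" where
  "path_weight n m l a b c = inv_fact n a * inv_fact m b * inv_fact l c"

text \<open>The coefficient of \<open>x^d / d!\<close> in \<open>(t x - 3 t)^k / k!\<close>, where \<open>x\<close> stands for the shift \<open>S\<close>.\<close>

definition pow_coeff :: "real \<Rightarrow> nat \<Rightarrow> nat \<Rightarrow> real" where
  "pow_coeff t d k = (if d \<le> k then (-3 * t)^(k - d) / fact (k - d) * t^d else 0)"

text \<open>This is \<open>(t x - 3 t)^(k + 1) = (t x - 3 t)^k (t x - 3 t)\<close> read off at \<open>x^d\<close>. For \<open>d = 0\<close> the factor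
  \<open>real d\<close> removes the last term, where \<open>d - 1\<close> is truncated.\<close>

lemma pow_coeff_Suc:
  "real (Suc k) * pow_coeff t d (Suc k) =
     -3 * t * pow_coeff t d k + t * (real d * pow_coeff t (d - 1) k)"
proof -
  consider "d > Suc k" | "d = Suc k" | "d \<le> k" by linarith
  then show ?thesis
  proof cases
    case 3
    define e where "e = k - d"
    have k: "k = d + e" using 3 by (simp add: e_def)
    show ?thesis
    proof (cases d)
      case 0
      then show ?thesis by (simp add: pow_coeff_def divide_simps)
    next
      case (Suc d')
      have "Suc k - d = Suc e" "k - d = e" "k - (d - 1) = Suc e" "d \<le> Suc k" "d \<le> k" "d - 1 \<le> k"
        using k Suc by auto
      then show ?thesis
        unfolding pow_coeff_def using k Suc
        by (simp add: divide_simps) (simp add: algebra_simps)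
    qed
  qed (auto simp: pow_coeff_def)
qed

text \<open>Multiplying by a column that is supported on a site and its three successors. The function is
  required to vanish just outside the lattice, so that successors beyond the boundary need no case
  distinction.\<close>

lemma sum_lattice_stencil:
  fixes F :: "nat \<Rightarrow> nat \<Rightarrow> nat \<Rightarrow> real"
  assumes "a < N" "b < N" "c < N"
    and "\<And>b c. F N b c = 0" "\<And>a c. F a N c = 0" "\<And>a b. F a b N = 0"
  shows "(\<Sum>x<N. \<Sum>y<N. \<Sum>z<N. F x y z *
      (if x = a \<and> y = b \<and> z = c then u
       else if x = Suc a \<and> y = b \<and> z = c \<or> x = a \<and> y = Suc b \<and> z = c \<or> x = a \<and> y = b \<and> z = Suc c
       then v else 0))
    = u * F a b c + v * (F (Suc a) b c + F a (Suc b) c + F a b (Suc c))"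
proof -
  have delta: "(\<Sum>x<N. \<Sum>y<N. \<Sum>z<N. if z = r then if y = q then if x = p then F x y z else 0 else 0 else 0)
      = F p q r" if "p \<le> N" "q \<le> N" "r \<le> N" for p q r
  proof -
    have "(\<Sum>x<N. \<Sum>y<N. \<Sum>z<N. if z = r then if y = q then if x = p then F x y z else 0 else 0 else 0)
      = (if p < N \<and> q < N \<and> r < N then F p q r else 0)"
    proof -
      have pull: "(\<Sum>z<N. if P then G z else 0) = (if P then sum G {..<N} else 0)"
        for P and G :: "nat \<Rightarrow> real"
        by simp
      show ?thesis by (simp add: pull sum.delta)
    qed
    also have "\<dots> = F p q r"
      using that assms(4,5,6) by (auto simp: not_less)
    finally show ?thesis .
  qed
  let ?D = "\<lambda>p q r x y z. if z = r then if y = q then if x = p then F x y z else 0 else 0 else 0"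
  have "(\<Sum>x<N. \<Sum>y<N. \<Sum>z<N. F x y z *
      (if x = a \<and> y = b \<and> z = c then u
       else if x = Suc a \<and> y = b \<and> z = c \<or> x = a \<and> y = Suc b \<and> z = c \<or> x = a \<and> y = b \<and> z = Suc c
       then v else 0))
    = (\<Sum>x<N. \<Sum>y<N. \<Sum>z<N. u * ?D a b c x y z
        + v * (?D (Suc a) b c x y z + ?D a (Suc b) c x y z + ?D a b (Suc c) x y z))"
    by (intro sum.cong refl) auto
  also have "\<dots> = u * F a b c + v * (F (Suc a) b c + F a (Suc b) c + F a b (Suc c))"
    using assms(1,2,3)
    by (simp only: sum.distrib sum_distrib_left[symmetric] delta Suc_leI less_imp_le)
  finally show ?thesis .
qed

text \<open>The closed form of the matrix powers. All paths between two sites have the same length, hence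
  only one power of \<open>S\<close> contributes to each entry.\<close>

lemma pow_L3_mat_entry:
  assumes "n < N" "m < N" "l < N" "a < N" "b < N" "c < N"
  shows "(((- t) \<cdot>\<^sub>m L3_mat N) ^\<^sub>m k) $$ (site N n m l, site N a b c) =
    fact k * (pow_coeff t (lat_dist n m l a b c) k * path_weight n m l a b c)"
  using assms(4-6)
proof (induction k arbitrary: a b c)
  case 0
  \<comment> \<open>Distinct coordinates give distinct sites: the entry of \<open>L3_mat N\<close> is \<open>3\<close> on the diagonal only.\<close>
  have "site N n m l = site N a b c \<longleftrightarrow> n = a \<and> m = b \<and> l = c"
  proof
    assume "site N n m l = site N a b c"
    then have "L3_mat N $$ (site N n m l, site N a b c) = L3_mat N $$ (site N a b c, site N a b c)"
      by simp
    then show "n = a \<and> m = b \<and> l = c"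
      using assms 0 by (auto simp: L3_mat_entry split: if_splits)
  qed simp
  moreover have "pow_coeff t (lat_dist n m l a b c) 0 * path_weight n m l a b c =
      (if n = a \<and> m = b \<and> l = c then 1 else 0)"
    by (auto simp: pow_coeff_def lat_dist_def path_weight_def inv_fact_def)
  moreover have "dim_row (L3_mat N) = N^3" using L3_mat_carrier by auto
  ultimately show ?case
    using site_less[OF assms(1-3)] site_less[OF 0] by simp
next
  case (Suc k)
  let ?A = "(- t) \<cdot>\<^sub>m L3_mat N"
  define F where "F x y z = pow_coeff t (lat_dist n m l x y z) k * path_weight n m l x y z" for x y z
  have dims: "dim_row (L3_mat N) = N^3" "dim_col (L3_mat N) = N^3"
    using L3_mat_carrier[of N] by auto
  have F0: "F N y z = 0" "F x N z = 0" "F x y N = 0" for x y z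
    using assms by (auto simp: F_def path_weight_def inv_fact_def)
  have "(?A ^\<^sub>m Suc k) $$ (site N n m l, site N a b c)
      = (\<Sum>j<N^3. (?A ^\<^sub>m k) $$ (site N n m l, j) * ?A $$ (j, site N a b c))"
    using site_less[OF assms(1-3)] site_less[OF Suc.prems] dims
    by (simp add: scalar_prod_def atLeast0LessThan)
  also have "\<dots> = (\<Sum>x<N. \<Sum>y<N. \<Sum>z<N. fact k * (F x y z *
      (if x = a \<and> y = b \<and> z = c then - 3 * t
       else if x = Suc a \<and> y = b \<and> z = c \<or> x = a \<and> y = Suc b \<and> z = c \<or> x = a \<and> y = b \<and> z = Suc c
       then t else 0)))"
    unfolding sum_lattice using Suc.prems
    by (intro sum.cong refl)
      (simp add: Suc.IH site_less dims L3_mat_entry F_def)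
  also have "\<dots> = fact k * (- 3 * t * F a b c + t * (F (Suc a) b c + F a (Suc b) c + F a b (Suc c)))"
    unfolding sum_distrib_left[symmetric]
    using sum_lattice_stencil[of a N b c F, OF Suc.prems F0] by simp
  also have "F (Suc a) b c + F a (Suc b) c + F a b (Suc c) =
      real (lat_dist n m l a b c) * pow_coeff t (lat_dist n m l a b c - 1) k * path_weight n m l a b c"
  proof -
    let ?d = "lat_dist n m l a b c"
    have "F (Suc a) b c = real (n - a) * (pow_coeff t (?d - 1) k * path_weight n m l a b c)"
      by (cases "a < n") (auto simp: F_def path_weight_def inv_fact_Suc lat_dist_def)
    moreover have "F a (Suc b) c = real (m - b) * (pow_coeff t (?d - 1) k * path_weight n m l a b c)"
      by (cases "b < m") (auto simp: F_def path_weight_def inv_fact_Suc lat_dist_def)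
    moreover have "F a b (Suc c) = real (l - c) * (pow_coeff t (?d - 1) k * path_weight n m l a b c)"
      by (cases "c < l") (auto simp: F_def path_weight_def inv_fact_Suc lat_dist_def)
    ultimately show ?thesis by (simp add: lat_dist_def algebra_simps)
  qed
  also have "fact k * (- 3 * t * F a b c + t * (real (lat_dist n m l a b c) *
        pow_coeff t (lat_dist n m l a b c - 1) k * path_weight n m l a b c)) =
      fact k * (real (Suc k) * pow_coeff t (lat_dist n m l a b c) (Suc k)) * path_weight n m l a b c"
    unfolding pow_coeff_Suc by (simp add: F_def algebra_simps)
  finally show ?case by (simp add: mult.assoc mult.left_commute)
qed

lemma pow_coeff_sums: "pow_coeff t d sums (exp (- 3 * t) * t^d)"
proof -
  have "(\<lambda>k. (-3 * t)^k / fact k) sums exp (-3 * t)"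
    using exp_converges[of "-3 * t"] by (simp add: field_simps)
  then have "(\<lambda>k. (-3 * t)^k / fact k * t^d) sums (exp (-3 * t) * t^d)"
    by (rule sums_mult2)
  \<comment> \<open>The first \<open>d\<close> coefficients vanish, so the series is a shifted exponential series.\<close>
  then have "(\<lambda>k. pow_coeff t d (k + d)) sums (exp (-3 * t) * t^d)"
    by (simp add: pow_coeff_def)
  then show ?thesis
    by (subst (asm) sums_iff_shift) (simp add: pow_coeff_def)
qed

lemma mat_exp_L3_entry:
  assumes "n < N" "m < N" "l < N" "a < N" "b < N" "c < N"
  shows "mat_exp ((- t) \<cdot>\<^sub>m L3_mat N) $$ (site N n m l, site N a b c) =
    exp (- 3 * t) * t ^ lat_dist n m l a b c * path_weight n m l a b c"
proof -
  have "dim_row (L3_mat N) = N^3" using L3_mat_carrier by auto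
  then have "mat_exp ((- t) \<cdot>\<^sub>m L3_mat N) $$ (site N n m l, site N a b c)
     = (\<Sum>k. pow_coeff t (lat_dist n m l a b c) k * path_weight n m l a b c)"
    using assms by (simp add: mat_exp_def site_less pow_L3_mat_entry)
  also have "\<dots> = exp (- 3 * t) * t ^ lat_dist n m l a b c * path_weight n m l a b c"
    by (rule sums_unique[symmetric], rule sums_mult2, rule pow_coeff_sums)
  finally show ?thesis .
qed

lemma pow_mat_transpose:
  fixes A :: "'a::comm_semiring_1 mat"
  assumes "A \<in> carrier_mat n n"
  shows "A\<^sup>T ^\<^sub>m k = (A ^\<^sub>m k)\<^sup>T"
proof (induction k)
  case 0
  then show ?case using assms by simp
next
  case (Suc k)
  have comm: "A * A ^\<^sub>m k = A ^\<^sub>m k * A"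
  proof (induction k)
    case (Suc k)
    have "A * A ^\<^sub>m Suc k = A * A ^\<^sub>m k * A"
      using assms by (simp add: assoc_mult_mat[of A n n _ n _ n])
    then show ?case using Suc by simp
  qed (use assms in simp)
  have "A\<^sup>T ^\<^sub>m Suc k = (A ^\<^sub>m k)\<^sup>T * A\<^sup>T" using Suc by simp
  also have "\<dots> = (A * A ^\<^sub>m k)\<^sup>T"
    using assms by (subst transpose_mult[of A n n _ n]) auto
  finally show ?case using comm by simp
qed

lemma mat_exp_transpose:
  assumes "A \<in> carrier_mat n n"
  shows "mat_exp A\<^sup>T = (mat_exp A)\<^sup>T"
  using assms by (intro eq_matI) (auto simp: mat_exp_def pow_mat_transpose)

lemma cov_integrand_entry:
  assumes "n < N" "m < N" "l < N" "n' < N" "m' < N" "l' < N"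
  shows "cov_integrand N t $$ (site N n m l, site N n' m' l') =
    (\<Sum>a<N. \<Sum>b<N. \<Sum>c<N. path_weight n m l a b c * path_weight n' m' l' a b c *
       (exp (- 6 * t) * t ^ (lat_dist n m l a b c + lat_dist n' m' l' a b c)))"
proof -
  let ?A = "(- t) \<cdot>\<^sub>m L3_mat N"
  have A: "?A \<in> carrier_mat (N^3) (N^3)" using L3_mat_carrier by simp
  have dims: "dim_row (mat_exp ?A) = N^3" "dim_col (mat_exp ?A) = N^3"
    using A by (auto simp: mat_exp_def)
  have "- t \<cdot>\<^sub>m (L3_mat N)\<^sup>T = ?A\<^sup>T" by (intro eq_matI) auto
  then have "cov_integrand N t = mat_exp ?A * (mat_exp ?A)\<^sup>T"
    by (simp add: cov_integrand_def mat_exp_transpose[OF A])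
  then have "cov_integrand N t $$ (site N n m l, site N n' m' l') =
      (\<Sum>j<N^3. mat_exp ?A $$ (site N n m l, j) * mat_exp ?A $$ (site N n' m' l', j))"
    using dims assms by (simp add: site_less scalar_prod_def atLeast0LessThan)
  also have "\<dots> = (\<Sum>a<N. \<Sum>b<N. \<Sum>c<N. path_weight n m l a b c * path_weight n' m' l' a b c *
       (exp (- 6 * t) * t ^ (lat_dist n m l a b c + lat_dist n' m' l' a b c)))"
  proof -
    have "exp (- 6 * t) = exp (- 3 * t) * exp (- 3 * t)"
      by (simp add: exp_add[symmetric])
    then show ?thesis
      unfolding sum_lattice using assms
      by (intro sum.cong refl) (simp add: mat_exp_L3_entry power_add)
  qed
  finally show ?thesis .
qed

lemma power_exp_integrable: "(\<lambda>t::real. exp (- 6 * t) * t ^ k) integrable_on {0..}"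
proof (rule integrable_on_all_intervals_integrable_bound)
  have "(\<lambda>t::real. exp (- 5 * t)) integrable_on {0..}"
    using integrable_on_exp_minus_to_infinity[of 5 0] by simp
  then show "(\<lambda>t::real. fact k * exp (- 5 * t)) integrable_on {0..}"
    by (rule integrable_on_mult_right)
next
  fix t :: real assume "t \<in> {0..}"
  then have t: "t \<ge> 0" by simp
  have "t ^ k / fact k \<le> exp t"
    using sum_le_suminf[OF summable_exp[of t], of "{k}"] t
    by (simp add: exp_def scaleR_conv_of_real field_simps)
  then have "t ^ k \<le> fact k * exp t" by (simp add: field_simps)
  then have "exp (- 6 * t) * t ^ k \<le> exp (- 6 * t) * (fact k * exp t)"
    by (intro mult_left_mono) auto
  also have "\<dots> = fact k * exp (- 5 * t)" by (simp add: exp_add[symmetric])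
  finally show "norm (exp (- 6 * t) * t ^ k) \<le> fact k * exp (- 5 * t)" using t by simp
next
  fix a b :: real
  have "(\<lambda>t::real. exp (- 6 * t) * t ^ k) integrable_on {max a 0..b}"
    by (intro integrable_continuous_interval continuous_intros)
  moreover have "{max a 0..b} = {0..} \<inter> cbox a b" by auto
  ultimately have "(\<lambda>t::real. exp (- 6 * t) * t ^ k) integrable_on {0..} \<inter> cbox a b"
    by (simp only:)
  then show "(\<lambda>t. if t \<in> {0..} then exp (- 6 * t) * t ^ k else 0) integrable_on cbox a b"
    by (simp only: integrable_restrict_Int)
qed

lemma cov_integrand_integrable:
  assumes "i < N^3" "j < N^3"
  shows "(\<lambda>t. cov_integrand N t $$ (i, j)) integrable_on {0..}"
proof -
  obtain n m l where i: "n < N" "m < N" "l < N" "i = site N n m l"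
    using assms(1) by (rule site_cases)
  obtain n' m' l' where j: "n' < N" "m' < N" "l' < N" "j = site N n' m' l'"
    using assms(2) by (rule site_cases)
  show ?thesis
    unfolding i(4) j(4) cov_integrand_entry[OF i(1-3) j(1-3)]
    by (intro integrable_sum finite_lessThan integrable_on_mult_right power_exp_integrable)
qed

section \<open>Decay of the diagonal entries\<close>

text \<open>The sum of the squares of the Poisson weights \<open>exp (- t) t^k / k!\<close> for \<open>k \<le> n\<close>: the contribution of
  one coordinate direction to the variance density of the follower at \<open>(n, n, n)\<close>.\<close>

definition chain_energy :: "nat \<Rightarrow> real \<Rightarrow> real" where
  "chain_energy n t = exp (- 2 * t) * (\<Sum>k\<le>n. (t ^ k / fact k)^2)"

lemma cov_integrand_diagonal:
  assumes "n < N"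
  shows "cov_integrand N t $$ (site N n n n, site N n n n) = chain_energy n t ^ 3"
proof -
  have chain: "(\<Sum>a<N. (inv_fact n a)^2 * t^(2 * (n - a))) = (\<Sum>k\<le>n. (t ^ k / fact k)^2)"
  proof -
    have "(\<Sum>a<N. (inv_fact n a)^2 * t^(2 * (n - a))) = (\<Sum>a\<le>n. (inv_fact n a)^2 * t^(2 * (n - a)))"
      using assms by (intro sum.mono_neutral_right) (auto simp: inv_fact_def)
    also have "\<dots> = (\<Sum>a\<le>n. (t ^ (n - a) / fact (n - a))^2)"
      by (intro sum.cong) (auto simp: inv_fact_def power_divide power_mult mult.commute)
    also have "\<dots> = (\<Sum>k\<le>n. (t ^ k / fact k)^2)"
      by (rule sum.reindex_bij_witness[of _ "\<lambda>k. n - k" "\<lambda>k. n - k"]) auto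
    finally show ?thesis .
  qed
  have prod3: "(\<Sum>a<N. \<Sum>b<N. \<Sum>c<N. e * (g a * g b * g c)) = e * (\<Sum>a<N. g a)^3"
    for e :: real and g
    by (simp add: power3_eq_cube sum_distrib_left sum_distrib_right mult_ac)
  have even: "t ^ (2 * k) = t ^ k * t ^ k" for k
    by (simp add: mult_2 power_add)
  have "cov_integrand N t $$ (site N n n n, site N n n n) =
     (\<Sum>a<N. \<Sum>b<N. \<Sum>c<N. exp (- 6 * t) * (((inv_fact n a)^2 * t^(2 * (n - a))) *
        ((inv_fact n b)^2 * t^(2 * (n - b))) * ((inv_fact n c)^2 * t^(2 * (n - c)))))"
    unfolding cov_integrand_entry[OF assms assms assms assms assms assms]
    by (intro sum.cong refl)
      (simp only: path_weight_def lat_dist_def power_add power2_eq_square even, simp only: mult_ac)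
  also have "\<dots> = exp (- 6 * t) * (\<Sum>k\<le>n. (t ^ k / fact k)^2)^3"
    unfolding prod3 chain ..
  also have "\<dots> = chain_energy n t ^ 3"
    by (simp add: chain_energy_def power_mult_distrib exp_of_nat_mult[symmetric])
  finally show ?thesis .
qed

text \<open>The normalised central binomial coefficient \<open>(2 k choose k) / 4^k\<close>, written with factorials.\<close>

definition central :: "nat \<Rightarrow> real" where
  "central k = fact (2 * k) / (fact k ^ 2 * 4 ^ k)"

lemma central_Suc: "central (Suc k) = central k * (2 * real k + 1) / (2 * real k + 2)"
proof -
  have "fact (2 * Suc k) = (2 * real k + 2) * ((2 * real k + 1) * fact (2 * k))"
    by (simp add: algebra_simps)
  moreover have "fact (Suc k) ^ 2 * 4 ^ Suc k = (2 * real k + 2)^2 * (fact k ^ 2 * 4 ^ k)"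
    by (simp add: power2_eq_square algebra_simps)
  ultimately show ?thesis
    unfolding central_def by (simp add: divide_simps power2_eq_square)
qed

text \<open>The left-hand side is decreasing in \<open>k\<close>, because \<open>(2 k + 3) (2 k + 1) \<le> (2 k + 2)\<^sup>2\<close>.\<close>

lemma central_bound: "(2 * real k + 1) * central k ^ 2 \<le> 1"
proof (induction k)
  case 0
  then show ?case by (simp add: central_def)
next
  case (Suc k)
  have "(2 * real (Suc k) + 1) * central (Suc k) ^ 2 =
     ((2 * real k + 1) * central k ^ 2) * ((2 * real k + 3) * (2 * real k + 1) / (2 * real k + 2)^2)"
    unfolding central_Suc by (simp add: power2_eq_square)
  also have "\<dots> \<le> 1 * 1"
  proof (rule mult_mono)
    show "(2 * real k + 3) * (2 * real k + 1) / (2 * real k + 2)^2 \<le> 1"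
      by (simp add: divide_simps power2_eq_square) (simp add: algebra_simps)
  qed (use Suc in auto)
  finally show ?case by simp
qed

lemma chain_energy_bounds:
  assumes "t \<ge> 0"
  shows "0 \<le> chain_energy n t" "chain_energy n t \<le> 1" "2 * t * chain_energy n t ^ 2 \<le> 1"
proof -
  define s where "s = 2 * t"
  define h where "h j = s ^ j / fact j" for j
  have s: "s \<ge> 0" using assms by (simp add: s_def)
  have h0: "h j \<ge> 0" for j using s by (simp add: h_def)
  define S where "S = (\<Sum>k\<le>n. (t ^ k / fact k)^2)"
  have S0: "S \<ge> 0" unfolding S_def by (intro sum_nonneg) auto
  have term_eq: "(t ^ k / fact k)^2 = h (2 * k) * central k" for k
  proof -
    have "s ^ (2 * k) = t ^ (2 * k) * 4 ^ k"
      by (simp add: s_def power_mult_distrib power_mult)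
    then show ?thesis
      by (simp add: h_def central_def power_divide power_mult[symmetric] mult.commute)
  qed
  have c0: "central k \<ge> 0" for k by (simp add: central_def)
  have c1: "central k \<le> 1" for k
  proof -
    have "central k ^ 2 \<le> (2 * real k + 1) * central k ^ 2"
      using mult_right_mono[of 1 "2 * real k + 1" "central k ^ 2"] by simp
    then have "central k ^ 2 \<le> 1" using central_bound[of k] by linarith
    then show ?thesis using c0 by (simp add: power_le_one_iff abs_square_le_1)
  qed
  have "(\<Sum>k\<le>n. h (2 * k)) + (\<Sum>k\<le>n. h (2 * k + 1)) = (\<Sum>j<2 * n + 2. h j)"
    by (induction n) (auto simp: lessThan_Suc)
  also have "\<dots> \<le> exp s"
  proof -
    have "h = (\<lambda>j. s ^ j /\<^sub>R fact j)" by (auto simp: h_def field_simps)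
    then have "summable h" "suminf h = exp s"
      using summable_exp_generic[of s] by (simp_all add: exp_def)
    then show ?thesis using sum_le_suminf[of h "{..<2 * n + 2}"] h0 by simp
  qed
  finally have parts: "(\<Sum>k\<le>n. h (2 * k)) + (\<Sum>k\<le>n. h (2 * k + 1)) \<le> exp s" .
  have nn: "(\<Sum>k\<le>n. h (2 * k)) \<ge> 0" "(\<Sum>k\<le>n. h (2 * k + 1)) \<ge> 0"
    by (auto intro!: sum_nonneg h0)
  have even: "(\<Sum>k\<le>n. h (2 * k)) \<le> exp s" and odd: "(\<Sum>k\<le>n. h (2 * k + 1)) \<le> exp s"
    using parts nn by linarith+
  have S: "S = (\<Sum>k\<le>n. h (2 * k) * central k)" unfolding S_def term_eq ..
  have "S \<le> (\<Sum>k\<le>n. h (2 * k))"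
    unfolding S by (intro sum_mono) (use h0 c1 in \<open>auto intro: mult_right_le_one_le c0\<close>)
  with even have S1: "S \<le> exp s" by linarith
  \<comment> \<open>Cauchy-Schwarz with weights \<open>h (2 * k)\<close>.\<close>
  have "S = (\<Sum>k\<le>n. sqrt (h (2 * k)) * (sqrt (h (2 * k)) * central k))"
    unfolding S using h0 by (intro sum.cong) (auto simp: mult.assoc[symmetric])
  then have "S^2 \<le> (\<Sum>k\<le>n. (sqrt (h (2 * k)))^2) * (\<Sum>k\<le>n. (sqrt (h (2 * k)) * central k)^2)"
    using Cauchy_Schwarz_ineq_sum by metis
  also have "\<dots> = (\<Sum>k\<le>n. h (2 * k)) * (\<Sum>k\<le>n. h (2 * k) * central k ^ 2)"
    using h0 by (simp add: power_mult_distrib)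
  finally have "s * S^2 \<le> (\<Sum>k\<le>n. h (2 * k)) * (s * (\<Sum>k\<le>n. h (2 * k) * central k ^ 2))"
    using mult_left_mono[OF _ s] by (simp add: mult.left_commute)
  \<comment> \<open>The factor \<open>1 / (2 * k + 1)\<close> turns the even exponential terms, times \<open>s\<close>, into the odd ones.\<close>
  also have "s * (\<Sum>k\<le>n. h (2 * k) * central k ^ 2) \<le> (\<Sum>k\<le>n. h (2 * k + 1))"
    unfolding sum_distrib_left
  proof (rule sum_mono)
    fix k
    have "s * h (2 * k) = (2 * real k + 1) * h (2 * k + 1)"
      by (simp add: h_def divide_simps)
    then have "s * (h (2 * k) * central k ^ 2) = h (2 * k + 1) * ((2 * real k + 1) * central k ^ 2)"
      by (metis mult.assoc mult.commute)
    also have "\<dots> \<le> h (2 * k + 1) * 1" by (intro mult_left_mono central_bound h0)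
    finally show "s * (h (2 * k) * central k ^ 2) \<le> h (2 * k + 1)" by simp
  qed
  then have "(\<Sum>k\<le>n. h (2 * k)) * (s * (\<Sum>k\<le>n. h (2 * k) * central k ^ 2)) \<le> exp s * exp s"
    using even odd nn s h0
    by (intro mult_mono) (auto intro!: mult_nonneg_nonneg sum_nonneg)
  finally have S2: "s * S^2 \<le> exp s * exp s" .
  have E: "chain_energy n t = exp (- s) * S" by (simp add: chain_energy_def S_def s_def)
  show "0 \<le> chain_energy n t" using S0 by (simp add: E)
  show "chain_energy n t \<le> 1"
    using mult_left_mono[OF S1, of "exp (- s)"] by (simp add: E exp_minus)
  have "2 * t * chain_energy n t ^ 2 = (exp (- s))^2 * (s * S^2)"
    by (simp add: E s_def power_mult_distrib)
  also have "\<dots> \<le> (exp (- s))^2 * (exp s * exp s)" by (intro mult_left_mono S2) auto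
  also have "\<dots> = 1" by (simp add: power2_eq_square exp_minus divide_simps)
  finally show "2 * t * chain_energy n t ^ 2 \<le> 1" .
qed

lemma chain_energy_cube_le:
  assumes "t \<ge> 1"
  shows "chain_energy n t ^ 3 \<le> t powr (- 3 / 2)"
proof -
  note b = chain_energy_bounds[of t n]
  have "chain_energy n t ^ 2 \<le> 1 / t"
    using b(3) assms by (simp add: field_simps)
  also have "1 / t = (t powr (- 1 / 2))^2"
    using assms by (simp add: powr_power powr_minus_divide[of t 1, simplified])
  finally have "chain_energy n t \<le> t powr (- 1 / 2)"
    by (rule power2_le_imp_le) simp
  then have "chain_energy n t ^ 3 \<le> (t powr (- 1 / 2)) ^ 3"
    using b assms by (intro power_mono) auto
  also have "\<dots> = t powr (- 3 / 2)" using assms by (simp add: powr_power)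
  finally show ?thesis .
qed

lemma integral_chain_energy_cube_le:
  assumes "(\<lambda>t. chain_energy n t ^ 3) integrable_on {0..}"
  shows "integral {0..} (\<lambda>t. chain_energy n t ^ 3) \<le> 3"
proof -
  define G :: "real \<Rightarrow> real" where "G t = (if t \<in> {0..1} then 1 else t powr (- 3 / 2))" for t
  have "((\<lambda>t::real. t powr (- 3 / 2)) has_integral 2) {1..}"
    using has_integral_powr_to_inf[of "- 3 / 2" 1] by simp
  then have "(G has_integral 2) {1..}"
    by (rule has_integral_eq[rotated]) (auto simp: G_def)
  moreover have "(G has_integral 1) {0..1}"
  proof (rule has_integral_eq)
    show "((\<lambda>_. 1::real) has_integral 1) {0..1::real}"
      using has_integral_const_real[of "1::real" 0 1] by simp
  qed (simp add: G_def)
  ultimately have "(G has_integral (1 + 2)) ({0..1} \<union> {1..})"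
    by (intro has_integral_Un) auto
  moreover have "{0..1} \<union> {1..} = {0::real..}" by auto
  ultimately have G: "(G has_integral 3) {0..}" by simp
  show ?thesis
  proof (rule has_integral_le[OF integrable_integral[OF assms] G])
    fix t :: real assume "t \<in> {0..}"
    then show "chain_energy n t ^ 3 \<le> G t"
      using chain_energy_cube_le[of t n] chain_energy_bounds(1,2)[of t n]
      by (auto simp: G_def intro: power_le_one)
  qed
qed

theorem proposition2:
  shows "(\<forall>N\<ge>1. \<forall>i<N^3. \<forall>j<N^3. (\<lambda>t. cov_integrand N t $$ (i, j)) integrable_on {0..})
    \<and> (\<exists>C::real. \<forall>N\<ge>1. \<forall>n\<in>{1..N}. follower_variance N n n n \<le> C)"
proof (intro conjI exI[of _ 3] allI impI ballI)
  fix N i j :: nat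
  assume "i < N^3" "j < N^3"
  then show "(\<lambda>t. cov_integrand N t $$ (i, j)) integrable_on {0..}"
    by (rule cov_integrand_integrable)
next
  fix N n :: nat
  assume n: "n \<in> {1..N}"
  define p where "p = n - 1"
  have p: "p < N" using n by (auto simp: p_def)
  let ?i = "site N p p p"
  have i: "lattice_index N n n n = ?i"
    by (simp add: lattice_index_def site_def p_def)
  have less: "?i < N^3" using p by (simp add: site_less)
  have "(\<lambda>t. chain_energy p t ^ 3) integrable_on {0..}"
    using cov_integrand_integrable[OF less less] by (simp add: cov_integrand_diagonal[OF p])
  then have "integral {0..} (\<lambda>t. chain_energy p t ^ 3) \<le> 3"
    by (rule integral_chain_energy_cube_le)
  then show "follower_variance N n n n \<le> 3"
    using less by (simp add: follower_variance_def steady_state_cov_def i cov_integrand_diagonal[OF p])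
qed

end
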